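(* Let $\mathcal F$ be a finite set of flows, $\mathcal R$ a finite set of APs with $|\mathcal R|=R\ge 2$, costs $e_i^f>0$ and payments $C^f\ge 0$ ($i\in\mathcal R$, $f\in\mathcal F$). Let $(\mathcal S_f)_{f\in\mathcal F}$ be the sets computed by the algorithm described in the context, and define, for $f\in\mathcal F$ and $i\in\mathcal R$, $$\widetilde r_i^f=\frac{(|\mathcal S_f|-1)C^f}{\sum_{j\in\mathcal S_f}e_j^f}\left(1-\frac{(|\mathcal S_f|-1)e_i^f}{\sum_{j\in\mathcal S_f}e_j^f}\right)\ \text{ if } i\in\mathcal S_f,\qquad \widetilde r_i^f=0\ \text{ otherwise}.$$ Then, for every $f\in\mathcal F$, $\widetilde{\mathbf r}^f=(\widetilde r_i^f)_{i\in\mathcal R}$ is a Nash equilibrium of $FG(f)$, and $\widetilde{\mathbf r}=(\widetilde{\mathbf r}^f)_{f\in\mathcal F}$ is a Nash equilibrium of the followers' game without capacity limit.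
   Context: Followers' game without capacity limit: the players are the APs $i\in\mathcal R$; AP $i$ chooses $\mathbf r_i=(r_i^f)_{f\in\mathcal F}\in[0,\infty)^{\mathcal F}$ and its payoff is $V_i=\sum_{f\in\mathcal F}V_i^f$, where $$V_i^f=C^f\frac{r_i^f}{\sum_{j\in\mathcal R}r_j^f}-e_i^f r_i^f,$$ with the fraction read as $0$ when $r_j^f=0$ for all $j\in\mathcal R$. $FG(f)$ is the game with players $\mathcal R$ in which AP $i$ chooses $r_i^f\in[0,\infty)$ and has payoff $V_i^f$. Algorithm for the sets $\mathcal S_f$. For each $f\in\mathcal F$: sort the APs so that $e^f_{\sigma_1}\le e^f_{\sigma_2}\le\cdots\le e^f_{\sigma_R}$; start with $\mathcal S_f=\{\sigma_1,\sigma_2\}$ and $i=3$; while $i\le R$ and $e^f_{\sigma_i}<\frac{\sum_{j\in\mathcal S_f}e_j^f}{|\mathcal S_f|-1}$, replace $\mathcal S_f$ by $\mathcal S_f\cup\{\sigma_i\}$ and $i$ by $i+1$. Output the final $\mathcal S_f$. *)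

theory Defs
  imports Complex_Main "HOL-Library.FuncSet" "HOL-Library.While_Combinator"
begin

record ('p, 's) game =
  players :: "'p set"
  strategies :: "'p \<Rightarrow> 's set"
  payoff :: "('p \<Rightarrow> 's) \<Rightarrow> 'p \<Rightarrow> real"

definition nash_equilibrium :: "('p, 's) game \<Rightarrow> ('p \<Rightarrow> 's) \<Rightarrow> bool" where
  "nash_equilibrium G s \<longleftrightarrow>
     (\<forall>i\<in>players G. s i \<in> strategies G i) \<and>
     (\<forall>i\<in>players G. \<forall>a\<in>strategies G i. payoff G (s(i := a)) i \<le> payoff G s i)"

text \<open>Throughout, \<open>R\<close> is the set of APs, \<open>F\<close> the set of flows, \<open>C f\<close> the payment for flow \<open>f\<close>
  and \<open>e f i\<close> the cost of AP \<open>i\<close> for flow \<open>f\<close>. Constants that concern a single flow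
  take the number \<open>c = C f\<close> and the function \<open>ef = e f\<close> as arguments.\<close>

definition flow_payoff :: "'r set \<Rightarrow> real \<Rightarrow> ('r \<Rightarrow> real) \<Rightarrow> ('r \<Rightarrow> real) \<Rightarrow> 'r \<Rightarrow> real" where
  "flow_payoff R c ef r i =
     c * (if \<forall>j\<in>R. r j = 0 then 0 else r i / (\<Sum>j\<in>R. r j)) - ef i * r i"

definition flow_game :: "'r set \<Rightarrow> real \<Rightarrow> ('r \<Rightarrow> real) \<Rightarrow> ('r, real) game" where
  "flow_game R c ef =
     \<lparr>players = R, strategies = (\<lambda>i. {0..}), payoff = flow_payoff R c ef\<rparr>"

text \<open>The strategy space \<open>[0,\<infinity>)\<close> to the power \<open>F\<close> is modelled by extensional functions on \<open>F\<close>,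
  so strategies are elements of a \<open>PiE\<close> set.\<close>

definition followers_game ::
    "'f set \<Rightarrow> 'r set \<Rightarrow> ('f \<Rightarrow> real) \<Rightarrow> ('f \<Rightarrow> 'r \<Rightarrow> real) \<Rightarrow> ('r, 'f \<Rightarrow> real) game" where
  "followers_game F R C e =
     \<lparr>players = R,
      strategies = (\<lambda>i. PiE F (\<lambda>f. {0..})),
      payoff = (\<lambda>r i. \<Sum>f\<in>F. flow_payoff R (C f) (e f) (\<lambda>j. r j f) i)\<rparr>"

definition sorts_APs :: "'r set \<Rightarrow> ('r \<Rightarrow> real) \<Rightarrow> (nat \<Rightarrow> 'r) \<Rightarrow> bool" where
  "sorts_APs R ef \<sigma> \<longleftrightarrow>
     bij_betw \<sigma> {1..card R} R \<and> mono_on {1..card R} (\<lambda>i. ef (\<sigma> i))"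

text \<open>The loop state is the pair of the current set and the index of the next AP to be tested.
  The algorithm is only meant for \<open>card R \<ge> 2\<close>.\<close>

definition selected_APs :: "'r set \<Rightarrow> ('r \<Rightarrow> real) \<Rightarrow> (nat \<Rightarrow> 'r) \<Rightarrow> 'r set" where
  "selected_APs R ef \<sigma> =
     fst (while
       (\<lambda>(S, i). i \<le> card R \<and> ef (\<sigma> i) < (\<Sum>j\<in>S. ef j) / (real (card S) - 1))
       (\<lambda>(S, i). (S \<union> {\<sigma> i}, i + 1))
       ({\<sigma> 1, \<sigma> 2}, 3))"

definition flow_rate :: "'r set \<Rightarrow> real \<Rightarrow> ('r \<Rightarrow> real) \<Rightarrow> 'r \<Rightarrow> real" where
  "flow_rate S c ef i =
     (if i \<in> S
      then (real (card S) - 1) * c / (\<Sum>j\<in>S. ef j)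
             * (1 - (real (card S) - 1) * ef i / (\<Sum>j\<in>S. ef j))
      else 0)"

end

theory Submission
  imports Defs
begin

text \<open>Put \<open>E = (\<Sum>j\<in>S. e j)\<close> and \<open>k = card S\<close>. The loop stops with a set \<open>S\<close> such that
  \<open>(k - 1) * e j \<le> E\<close> for \<open>j \<in> S\<close> and \<open>E \<le> (k - 1) * e j\<close> for \<open>j \<notin> S\<close>. The rates then
  sum to \<open>T = (k - 1) * c / E\<close>. As a function of the own rate \<open>a\<close>, against the total rate \<open>B\<close>
  of the others, the payoff \<open>c * a / (a + B) - e i * a\<close> is concave, so \<open>r i\<close> is a best response iff
  \<open>c * B = e i * T\<^sup>2\<close>, or \<open>r i = 0\<close> and \<open>c * B \<le> e i * T\<^sup>2\<close>; the former holds on \<open>S\<close> and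
  the latter off \<open>S\<close>. In the followers' game the payoff is a sum over flows of terms that depend on
  disjoint coordinates, so equilibria of the games \<open>FG(f)\<close> combine.\<close>

lemma flow_payoff_eq:
  assumes "i \<in> R"
  shows "flow_payoff R c ef r i = c * (r i / (\<Sum>j\<in>R. r j)) - ef i * r i"
  using assms by (auto simp: flow_payoff_def)

text \<open>Concavity enters without derivatives: the gain from playing \<open>a\<close> instead of
  \<open>r\<close> is \<open>c * B * (a - r) / ((a + B) * (r + B)) - e * (a - r)\<close>, and
  inserting the first-order condition leaves at most a negative multiple of
  \<open>(a - r)\<^sup>2\<close>.\<close>

lemma contest_best_response:
  fixes a B c e r :: real
  assumes "B > 0" "r \<ge> 0" "a \<ge> 0" "e \<ge> 0"
    and le: "c * B \<le> e * (r + B)\<^sup>2"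
    and eq: "r \<noteq> 0 \<Longrightarrow> c * B = e * (r + B)\<^sup>2"
  shows "c * (a / (a + B)) - e * a \<le> c * (r / (r + B)) - e * r"
proof -
  have pos: "a + B > 0" "r + B > 0" using assms by auto
  \<comment> \<open>At the boundary \<open>r = 0\<close> the factor \<open>a - r\<close> is
    nonnegative, so the inequality \<open>le\<close> suffices; for \<open>r \<noteq> 0\<close> its
    sign is unknown and \<open>eq\<close> is used.\<close>
  have "c * B * (a - r) \<le> e * (r + B)\<^sup>2 * (a - r)"
    using le eq \<open>a \<ge> 0\<close> by (cases "r = 0") (auto intro: mult_right_mono)
  also have "\<dots> = e * (r + B) * ((a + B) * (a - r) - (a - r)\<^sup>2)"
    by (simp add: algebra_simps power2_eq_square)
  also have "\<dots> \<le> e * (r + B) * ((a + B) * (a - r))"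
    using pos \<open>e \<ge> 0\<close> by (intro mult_left_mono) auto
  finally have "c * B * (a - r) \<le> e * (a - r) * ((a + B) * (r + B))"
    by (simp add: mult_ac)
  then have "c * B * (a - r) / ((a + B) * (r + B)) \<le> e * (a - r)"
    using pos by (simp add: pos_divide_le_eq)
  moreover have "c * (a / (a + B)) - c * (r / (r + B)) = c * B * (a - r) / ((a + B) * (r + B))"
    using pos by (simp add: field_simps)
  ultimately show ?thesis by (simp add: algebra_simps)
qed

text \<open>With \<open>k = card S\<close>, the bracketed factors of the rates add up over
  \<open>S\<close> to \<open>k - (k - 1) = 1\<close>, which leaves the common prefactor.\<close>

lemma sum_flow_rate:
  assumes "finite R" "S \<subseteq> R" "(\<Sum>j\<in>S. ef j) \<noteq> 0"
  shows "(\<Sum>j\<in>R. flow_rate S c ef j) = (real (card S) - 1) * c / (\<Sum>j\<in>S. ef j)"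
proof -
  define E where "E = (\<Sum>j\<in>S. ef j)"
  define k where "k = real (card S)"
  have "(\<Sum>j\<in>R. flow_rate S c ef j) = (\<Sum>j\<in>S. flow_rate S c ef j)"
    using assms by (intro sum.mono_neutral_right) (auto simp: flow_rate_def)
  also have "\<dots> = (\<Sum>j\<in>S. (k - 1) * c / E * (1 - (k - 1) * ef j / E))"
    by (intro sum.cong) (auto simp: flow_rate_def E_def k_def)
  also have "\<dots> = (k - 1) * c / E * (\<Sum>j\<in>S. 1 - (k - 1) * ef j / E)"
    by (simp add: sum_distrib_left)
  also have "(\<Sum>j\<in>S. 1 - (k - 1) * ef j / E) = k - (k - 1) * E / E"
    by (simp add: sum_subtractf E_def k_def sum_divide_distrib[symmetric]
        sum_distrib_left[symmetric])
  also have "\<dots> = 1" using assms(3) by (simp add: E_def)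
  finally show ?thesis by (simp add: E_def k_def)
qed

text \<open>The hypothesis \<open>inside\<close> makes the rates on \<open>S\<close> nonnegative;
  \<open>outside\<close> says that the marginal payoff at rate zero is not positive off
  \<open>S\<close>.\<close>

lemma nash_equilibrium_flow_rate:
  assumes R: "finite R" "S \<subseteq> R" and card: "card S \<ge> 2" and c: "c \<ge> 0"
    and e_pos: "\<And>j. j \<in> R \<Longrightarrow> ef j > 0"
    and inside: "\<And>j. j \<in> S \<Longrightarrow> (real (card S) - 1) * ef j \<le> (\<Sum>j\<in>S. ef j)"
    and outside: "\<And>j. j \<in> R - S \<Longrightarrow> (\<Sum>j\<in>S. ef j) \<le> (real (card S) - 1) * ef j"
  shows "nash_equilibrium (flow_game R c ef) (flow_rate S c ef)"
proof -
  define E where "E = (\<Sum>j\<in>S. ef j)"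
  define k where "k = real (card S) - 1"
  define T where "T = k * c / E"
  define r where "r = flow_rate S c ef"
  have E: "E > 0"
    unfolding E_def using R card e_pos by (intro sum_pos) (auto intro: finite_subset)
  have k: "k > 0" using card by (simp add: k_def)
  have T: "(\<Sum>j\<in>R. r j) = T"
    using sum_flow_rate[OF R] E by (simp add: r_def T_def E_def k_def)
  have r_in: "r i = T * (1 - k * ef i / E)" if "i \<in> S" for i
    using that by (simp add: r_def flow_rate_def T_def E_def k_def)
  have r_out: "r i = 0" if "i \<notin> S" for i
    using that by (simp add: r_def flow_rate_def)
  have T_nonneg: "T \<ge> 0" using c k E by (simp add: T_def)
  have r_nonneg: "r i \<ge> 0" for i
  proof (cases "i \<in> S")
    case True
    have "k * ef i / E \<le> 1" using inside[OF True] E by (simp add: E_def k_def)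
    with r_in[OF True] T_nonneg show ?thesis by simp
  qed (simp add: r_out)
  have best: "flow_payoff R c ef (r(i := a)) i \<le> flow_payoff R c ef r i"
    if i: "i \<in> R" and a: "a \<ge> 0" for i a
  \<comment> \<open>For \<open>c = 0\<close> all rates vanish, so the total of the others is zero
    and \<open>contest_best_response\<close> does not apply; here a deviation only adds
    cost.\<close>
  proof (cases "c = 0")
    case True
    then have "r i = 0" using r_in[of i] r_out[of i] by (cases "i \<in> S") (auto simp: T_def)
    with True a e_pos[OF i] show ?thesis by (simp add: flow_payoff_eq[OF i])
  next
    case False
    with c have "c > 0" by simp
    define B where "B = (\<Sum>j\<in>R - {i}. r j)"
    have TB: "r i + B = T"
      using sum.remove[OF R(1) i, of r] by (simp add: T B_def)
    have sum_a: "(\<Sum>j\<in>R. (r(i := a)) j) = a + B"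
      using sum.remove[OF R(1) i, of "r(i := a)"] by (simp add: B_def)
    have T_pos: "T > 0" using \<open>c > 0\<close> k E by (simp add: T_def)
    have cond: "B > 0 \<and> c * B \<le> ef i * T\<^sup>2 \<and> (r i \<noteq> 0 \<longrightarrow> c * B = ef i * T\<^sup>2)"
    proof (cases "i \<in> S")
      case True
      have B: "B = T * (k * ef i / E)" using TB r_in[OF True] by (simp add: algebra_simps)
      then have "c * B = ef i * T\<^sup>2" by (simp add: T_def power2_eq_square)
      moreover have "B > 0" unfolding B using T_pos k E e_pos[OF i] by simp
      ultimately show ?thesis by simp
    next
      case False
      have B: "B = T" using TB r_out[OF False] by simp
      have "c * E \<le> c * (k * ef i)"
        using outside[of i] i False c unfolding E_def k_def by (intro mult_left_mono) auto
      then have "c \<le> ef i * T" using E by (simp add: T_def field_simps)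
      then have "c * T \<le> ef i * T * T" using T_pos by (intro mult_right_mono) auto
      with T_pos B r_out[OF False] show ?thesis by (simp add: power2_eq_square mult_ac)
    qed
    have "c * (a / (a + B)) - ef i * a \<le> c * (r i / (r i + B)) - ef i * r i"
      using cond r_nonneg[of i] a e_pos[OF i] TB by (intro contest_best_response) auto
    then show ?thesis by (simp add: flow_payoff_eq[OF i] sum_a T TB del: fun_upd_apply) simp
  qed
  then show ?thesis
    using r_nonneg by (auto simp: nash_equilibrium_def flow_game_def r_def)
qed

text \<open>The bound on members is a loop invariant; the bound on non-members comes from the exit
  condition together with sortedness.\<close>

lemma selected_APs_properties:
  fixes ef :: "'r \<Rightarrow> real"
  assumes card: "card R \<ge> 2" and e_pos: "\<And>i. i \<in> R \<Longrightarrow> ef i > 0"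
    and sorts: "sorts_APs R ef \<sigma>" and S: "S = selected_APs R ef \<sigma>"
  shows "S \<subseteq> R" "card S \<ge> 2"
    and "\<And>j. j \<in> S \<Longrightarrow> (real (card S) - 1) * ef j \<le> (\<Sum>j\<in>S. ef j)"
    and "\<And>j. j \<in> R - S \<Longrightarrow> (\<Sum>j\<in>S. ef j) \<le> (real (card S) - 1) * ef j"
proof -
  have bij: "bij_betw \<sigma> {1..card R} R" and mono: "mono_on {1..card R} (\<lambda>i. ef (\<sigma> i))"
    using sorts by (auto simp: sorts_APs_def)
  have inj: "inj_on \<sigma> {1..card R}" and img: "\<sigma> ` {1..card R} = R"
    using bij by (auto simp: bij_betw_def)
  have in_R: "\<sigma> i \<in> R" if "i \<in> {1..card R}" for i using img that by blast
  \<comment> \<open>The index may reach \<open>card R + 1\<close>, the value on exit when every AP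
    has been selected.\<close>
  define P :: "'r set \<times> nat \<Rightarrow> bool" where
    "P = (\<lambda>(A, i). 3 \<le> i \<and> i \<le> card R + 1 \<and> A = \<sigma> ` {1..<i} \<and>
        (\<forall>j\<in>A. (real (card A) - 1) * ef j \<le> sum ef A))"
  define Q :: "'r set \<Rightarrow> bool" where
    "Q = (\<lambda>A. A \<subseteq> R \<and> card A \<ge> 2 \<and> (\<forall>j\<in>A. (real (card A) - 1) * ef j \<le> sum ef A) \<and>
        (\<forall>j\<in>R - A. sum ef A \<le> (real (card A) - 1) * ef j))"
  have card_img: "card (\<sigma> ` {1..<i}) = i - 1" if "i \<le> card R + 1" for i
    using card_image[OF inj_on_subset[OF inj, of "{1..<i}"]] that by (simp add: subset_eq)
  have "Q S"
    unfolding S selected_APs_def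
  proof (rule while_rule[where P = P and r = "measure (\<lambda>(A, i). card R + 1 - i)"])
    have "{1..<3} = {1, 2 :: nat}" by auto
    then have start: "{\<sigma> 1, \<sigma> 2} = \<sigma> ` {1..<3}" by (simp only: image_insert image_empty)
    have "\<sigma> 1 \<noteq> \<sigma> 2" using inj_onD[OF inj, of 1 2] card by auto
    \<comment> \<open>As the two APs are distinct, the factor is 1, and positivity of the other cost
      gives the bound.\<close>
    then have "\<forall>j\<in>{\<sigma> 1, \<sigma> 2}. (real (card {\<sigma> 1, \<sigma> 2}) - 1) * ef j \<le> sum ef {\<sigma> 1, \<sigma> 2}"
      using card e_pos[OF in_R[of 1]] e_pos[OF in_R[of 2]] by auto
    with start card show "P ({\<sigma> 1, \<sigma> 2}, 3)" by (simp add: P_def)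
  next
    fix s assume "P s"
      and "case s of (A, i) \<Rightarrow> i \<le> card R \<and> ef (\<sigma> i) < (\<Sum>j\<in>A. ef j) / (real (card A) - 1)"
    then obtain A i where s: "s = (A, i)" and i: "3 \<le> i" "i \<le> card R"
      and A: "A = \<sigma> ` {1..<i}" and lt: "ef (\<sigma> i) < sum ef A / (real (card A) - 1)"
      by (auto simp: P_def)
    have cA: "real (card A) = real i - 1" using card_img[of i] i A by simp
    have fin: "finite A" using A by simp
    have notin: "\<sigma> i \<notin> A" using inj_onD[OF inj, of i] i by (force simp: A)
    have new: "(real (card A) - 1) * ef (\<sigma> i) \<le> sum ef A"
      using lt i by (simp add: cA field_simps)
    have "(real (card (insert (\<sigma> i) A)) - 1) * ef j \<le> sum ef (insert (\<sigma> i) A)"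
      if j: "j \<in> insert (\<sigma> i) A" for j
    proof -
      \<comment> \<open>The new AP is the most expensive member, so the bound is needed only for it,
        where it is the loop test with \<open>ef (\<sigma> i)\<close> added to both sides.\<close>
      have "ef j \<le> ef (\<sigma> i)" using j i by (auto simp: A intro!: mono_onD[OF mono])
      then have "real (card A) * ef j \<le> real (card A) * ef (\<sigma> i)" by (intro mult_left_mono) auto
      also have "\<dots> \<le> sum ef A + ef (\<sigma> i)" using new by (simp add: algebra_simps)
      finally show ?thesis using fin notin by simp
    qed
    moreover have "insert (\<sigma> i) A = \<sigma> ` {1..<i + 1}"
      using i by (auto simp: A atLeastLessThanSuc)
    ultimately show "P (case s of (A, i) \<Rightarrow> (A \<union> {\<sigma> i}, i + 1))"
      using i by (simp add: P_def s)
    show "(case s of (A, i) \<Rightarrow> (A \<union> {\<sigma> i}, i + 1), s) \<in> measure (\<lambda>(A, i). card R + 1 - i)"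
      using i by (simp add: s)
  next
    fix s assume "P s"
      and "\<not> (case s of (A, i) \<Rightarrow> i \<le> card R \<and> ef (\<sigma> i) < (\<Sum>j\<in>A. ef j) / (real (card A) - 1))"
    then obtain A i where s: "s = (A, i)" and i: "3 \<le> i" "i \<le> card R + 1"
      and A: "A = \<sigma> ` {1..<i}"
      and inside: "\<forall>j\<in>A. (real (card A) - 1) * ef j \<le> sum ef A"
      and stop: "i \<le> card R \<longrightarrow> sum ef A / (real (card A) - 1) \<le> ef (\<sigma> i)"
      by (cases s) (simp add: P_def not_less)
    have cA: "card A = i - 1" using card_img i A by simp
    \<comment> \<open>An unselected AP sits at a position \<open>m \<ge> i\<close>, so the failed
      test at \<open>i\<close> carries over to it. Its existence also gives
      \<open>i \<le> card R\<close>, which excludes exit by exhaustion.\<close>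
    have "sum ef A \<le> (real (card A) - 1) * ef j" if j: "j \<in> R - A" for j
    proof -
      obtain m where m: "m \<in> {1..card R}" "j = \<sigma> m" using j img by blast
      then have "i \<le> m" using j A by (metis DiffD2 atLeastAtMost_iff atLeastLessThan_iff imageI not_less)
      with m have "ef (\<sigma> i) \<le> ef j" using i by (auto intro!: mono_onD[OF mono])
      moreover have "sum ef A / (real (card A) - 1) \<le> ef (\<sigma> i)" using stop m \<open>i \<le> m\<close> by simp
      ultimately have "sum ef A / (real (card A) - 1) \<le> ef j" by simp
      then show ?thesis using i by (simp add: cA field_simps)
    qed
    moreover have "A \<subseteq> R" using i in_R by (auto simp: A)
    ultimately show "Q (fst s)" using i inside by (simp add: Q_def s cA)
  qed simp
  then show "S \<subseteq> R" "card S \<ge> 2"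
    and "\<And>j. j \<in> S \<Longrightarrow> (real (card S) - 1) * ef j \<le> (\<Sum>j\<in>S. ef j)"
    and "\<And>j. j \<in> R - S \<Longrightarrow> (\<Sum>j\<in>S. ef j) \<le> (real (card S) - 1) * ef j"
    by (auto simp: Q_def)
qed

text \<open>A deviation \<open>a\<close> affects flow \<open>f\<close> only through
  \<open>a f\<close>, so payoffs compare flow by flow. Restricting to \<open>F\<close> puts each
  strategy into the \<open>PiE\<close> set.\<close>

lemma nash_equilibrium_followers_game:
  assumes "\<And>f. f \<in> F \<Longrightarrow> nash_equilibrium (flow_game R (C f) (e f)) (r f)"
  shows "nash_equilibrium (followers_game F R C e) (\<lambda>i. \<lambda>f\<in>F. r f i)"
proof -
  let ?s = "\<lambda>i. \<lambda>f\<in>F. r f i"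
  have nonneg: "r f i \<ge> 0" if "f \<in> F" "i \<in> R" for f i
    using assms[OF that(1)] that(2) by (auto simp: nash_equilibrium_def flow_game_def)
  have "(\<Sum>f\<in>F. flow_payoff R (C f) (e f) (\<lambda>j. (?s(i := a)) j f) i)
      \<le> (\<Sum>f\<in>F. flow_payoff R (C f) (e f) (\<lambda>j. ?s j f) i)"
    if i: "i \<in> R" and a: "a \<in> PiE F (\<lambda>f. {0..})" for i a
  proof (rule sum_mono)
    fix f assume f: "f \<in> F"
    have "(\<lambda>j. (?s(i := a)) j f) = (r f)(i := a f)" "(\<lambda>j. ?s j f) = r f"
      using f by auto
    moreover have "a f \<ge> 0" using a f by (auto dest: PiE_mem)
    ultimately show "flow_payoff R (C f) (e f) (\<lambda>j. (?s(i := a)) j f) i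
        \<le> flow_payoff R (C f) (e f) (\<lambda>j. ?s j f) i"
      using assms[OF f] i by (simp add: nash_equilibrium_def flow_game_def)
  qed
  then show ?thesis
    using nonneg by (auto simp: nash_equilibrium_def followers_game_def)
qed

theorem theorem1:
  fixes F :: "'f set" and R :: "'r set"
    and C :: "'f \<Rightarrow> real" and e :: "'f \<Rightarrow> 'r \<Rightarrow> real"
    and \<sigma> :: "'f \<Rightarrow> nat \<Rightarrow> 'r" and S :: "'f \<Rightarrow> 'r set"
  assumes "finite F" and "finite R" and "card R \<ge> 2"
    and "\<And>f i. f \<in> F \<Longrightarrow> i \<in> R \<Longrightarrow> e f i > 0"
    and "\<And>f. f \<in> F \<Longrightarrow> C f \<ge> 0"
    and "\<And>f. f \<in> F \<Longrightarrow> sorts_APs R (e f) (\<sigma> f)"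
    and "\<And>f. f \<in> F \<Longrightarrow> S f = selected_APs R (e f) (\<sigma> f)"
  shows "(\<forall>f\<in>F. nash_equilibrium (flow_game R (C f) (e f)) (flow_rate (S f) (C f) (e f))) \<and>
    nash_equilibrium (followers_game F R C e) (\<lambda>i. \<lambda>f\<in>F. flow_rate (S f) (C f) (e f) i)"
proof -
  have "nash_equilibrium (flow_game R (C f) (e f)) (flow_rate (S f) (C f) (e f))"
    if f: "f \<in> F" for f
  proof -
    note sel = selected_APs_properties[OF assms(3) assms(4)[OF f] assms(6)[OF f] assms(7)[OF f]]
    show ?thesis
      by (rule nash_equilibrium_flow_rate[OF assms(2) sel(1,2) assms(5)[OF f] assms(4)[OF f] sel(3,4)])
  qed
  then show ?thesis by (simp add: nash_equilibrium_followers_game)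
qed

end
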